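(* Let $G$ be a finitely generated infinite group and let $\mu$ be a symmetric probability measure on $G$ of finite entropy, i.e. $H_\mu(1)=-\sum_{x\in G}\mu(x)\log\mu(x)<\infty$. Suppose that for all integers $n\ge 1$ $$\mu^{(2n)}(\mathrm{id})\ge \exp(-\gamma(n)),$$ where $\gamma:[1,\infty)\to\mathbb{R}_+=(0,\infty)$ is an unbounded function such that both $\gamma(n)$ and $n^{1/2}/\gamma(n)$ are increasing, and which satisfies $$\lim_{n\to\infty}\frac{\gamma(n)}{n^{1/2}}=0.$$ Then $(G,\mu)$ has the Liouville property.
   Context: A probability measure $\mu$ on a (discrete) group $G$ is symmetric if $\mu(g)=\mu(g^{-1})$ for all $g\in G$. $\mu^{(n)}$ denotes the $n$-fold convolution power of $\mu$, and $\mathrm{id}$ is the identity element of $G$. In the entropy, $0\log 0=0$. A function $h:G\to\mathbb{R}$ is $\mu$-harmonic if $h(x)=\sum_{y\in G}h(xy)\mu(y)$ for all $x\in G$. The pair $(G,\mu)$ has the Liouville property if all bounded $\mu$-harmonic functions on $G$ are constant.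
   Formalization: The support of μ is additionally assumed to generate G; without this the claim fails (μ the point mass at id on the integers, γ(n) = n^{1/4}), and the Liouville property itself forces this condition, so no valid case is lost. *)

theory Defs
  imports "HOL-Probability.Probability" "HOL-Algebra.Generated_Groups"
begin

text \<open>
  A finitely generated group is countable, so its probability measures are exactly the
  \<^typ>\<open>'a pmf\<close>s whose support lies in the carrier.
\<close>

definition prob_measure_on :: "('a, 'b) monoid_scheme \<Rightarrow> 'a pmf \<Rightarrow> bool" where
  "prob_measure_on G \<mu> \<longleftrightarrow> set_pmf \<mu> \<subseteq> carrier G"

definition finitely_generated_group :: "('a, 'b) monoid_scheme \<Rightarrow> bool" where
  "finitely_generated_group G \<longleftrightarrow>
     group G \<and> (\<exists>S. finite S \<and> S \<subseteq> carrier G \<and> generate G S = carrier G)"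

definition symmetric_pmf :: "('a, 'b) monoid_scheme \<Rightarrow> 'a pmf \<Rightarrow> bool" where
  "symmetric_pmf G \<mu> \<longleftrightarrow> (\<forall>g\<in>carrier G. pmf \<mu> g = pmf \<mu> (inv\<^bsub>G\<^esub> g))"

definition nondegenerate_pmf :: "('a, 'b) monoid_scheme \<Rightarrow> 'a pmf \<Rightarrow> bool" where
  "nondegenerate_pmf G \<mu> \<longleftrightarrow> generate G (set_pmf \<mu>) = carrier G"

definition convolution_pmf :: "('a, 'b) monoid_scheme \<Rightarrow> 'a pmf \<Rightarrow> 'a pmf \<Rightarrow> 'a pmf" where
  "convolution_pmf G \<mu> \<nu> = map_pmf (\<lambda>(x, y). x \<otimes>\<^bsub>G\<^esub> y) (pair_pmf \<mu> \<nu>)"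

primrec convolution_power :: "('a, 'b) monoid_scheme \<Rightarrow> 'a pmf \<Rightarrow> nat \<Rightarrow> 'a pmf" where
  "convolution_power G \<mu> 0 = return_pmf \<one>\<^bsub>G\<^esub>"
| "convolution_power G \<mu> (Suc n) = convolution_pmf G (convolution_power G \<mu> n) \<mu>"

text \<open>
  The entropy takes values in \<open>[0, \<infinity>]\<close>. Every summand is nonnegative, as \<open>\<mu>(x) \<le> 1\<close>, so
  \<^const>\<open>ennreal\<close> truncates nothing; \<open>0 log 0 = 0\<close> holds because \<^term>\<open>0 * ln 0 = (0::real)\<close>.
\<close>

definition shannon_entropy :: "('a, 'b) monoid_scheme \<Rightarrow> 'a pmf \<Rightarrow> ennreal" where
  "shannon_entropy G \<mu> = (\<Sum>\<^sub>\<infinity>x\<in>carrier G. ennreal (- (pmf \<mu> x * ln (pmf \<mu> x))))"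

text \<open>Using \<^const>\<open>has_sum\<close>, rather than \<^const>\<open>infsum\<close>, makes convergence part of harmonicity.\<close>

definition harmonic :: "('a, 'b) monoid_scheme \<Rightarrow> 'a pmf \<Rightarrow> ('a \<Rightarrow> real) \<Rightarrow> bool" where
  "harmonic G \<mu> h \<longleftrightarrow>
     (\<forall>x\<in>carrier G. ((\<lambda>y. h (x \<otimes>\<^bsub>G\<^esub> y) * pmf \<mu> y) has_sum h x) (carrier G))"

definition liouville :: "('a, 'b) monoid_scheme \<Rightarrow> 'a pmf \<Rightarrow> bool" where
  "liouville G \<mu> \<longleftrightarrow>
     (\<forall>h. harmonic G \<mu> h \<and> bounded (h ` carrier G) \<longrightarrow> h constant_on carrier G)"

text \<open>
  The Liouville property forces nondegeneracy: if the support generates a proper subgroup,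
  then the indicator function of that subgroup is bounded, harmonic and not constant.
\<close>

lemma pmf_has_sum_1:
  assumes "set_pmf \<mu> \<subseteq> A"
  shows "(pmf \<mu> has_sum 1) A"
proof -
  have "Infinite_Sum.abs_summable_on (pmf \<mu>) A"
    using pmf_abs_summable abs_summable_equivalent by blast
  then have s: "pmf \<mu> summable_on A"
    by (rule abs_summable_summable)
  have e: "infsetsum (pmf \<mu>) A = infsum (pmf \<mu>) A"
    by (rule infsetsum_infsum[OF pmf_abs_summable])
  have "infsetsum (pmf \<mu>) A = 1"
    using assms by (rule infsetsum_pmf_eq_1)
  with s e show ?thesis
    by (metis has_sum_infsum)
qed

lemma (in group) liouville_imp_nondegenerate:
  assumes \<mu>: "prob_measure_on G \<mu>" and L: "liouville G \<mu>"
  shows "nondegenerate_pmf G \<mu>"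
proof -
  let ?H = "generate G (set_pmf \<mu>)"
  let ?h = "\<lambda>x. if x \<in> ?H then 1 else (0::real)"
  have supp: "set_pmf \<mu> \<subseteq> carrier G"
    using \<mu> by (simp add: prob_measure_on_def)
  interpret H: subgroup ?H G
    by (rule generate_is_subgroup[OF supp])
  have "harmonic G \<mu> ?h"
    unfolding harmonic_def
  proof
    fix x assume x: "x \<in> carrier G"
    have step: "?h (x \<otimes> y) * pmf \<mu> y = ?h x * pmf \<mu> y" if "y \<in> carrier G" for y
    proof (cases "y \<in> set_pmf \<mu>")
      case True
      then have y: "y \<in> ?H" by (rule generate.incl)
      have "x \<in> ?H" if "x \<otimes> y \<in> ?H"
      proof -
        have "(x \<otimes> y) \<otimes> inv y \<in> ?H"
          using that y by blast
        then show ?thesis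
          using x \<open>y \<in> carrier G\<close> by (simp add: m_assoc)
      qed
      then have "x \<otimes> y \<in> ?H \<longleftrightarrow> x \<in> ?H"
        using y by blast
      then show ?thesis by simp
    qed (simp add: set_pmf_iff)
    have "((\<lambda>y. ?h x * pmf \<mu> y) has_sum ?h x * 1) (carrier G)"
      by (intro has_sum_cmult_right pmf_has_sum_1 supp)
    then show "((\<lambda>y. ?h (x \<otimes> y) * pmf \<mu> y) has_sum ?h x) (carrier G)"
      by (subst has_sum_cong[OF step]) simp_all
  qed
  moreover have "bounded (?h ` carrier G)"
    by (rule finite_imp_bounded, rule finite_subset[of _ "{0, 1}"]) auto
  ultimately have "?h constant_on carrier G"
    using L unfolding liouville_def by blast
  then obtain c where c: "?h x = c" if "x \<in> carrier G" for x
    unfolding constant_on_def by blast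
  have "x \<in> ?H" if "x \<in> carrier G" for x
  proof -
    have "?h x = ?h \<one>"
      using c[OF that] c[OF one_closed] by (rule trans[OF _ sym])
    then show ?thesis
      by (simp add: H.one_closed split: if_splits)
  qed
  then show ?thesis
    unfolding nondegenerate_pmf_def using H.subset by blast
qed

end

theory Submission
  imports Defs
begin

text \<open>
  Write \<open>P\<^sub>n\<close> for the mass function of \<open>\<mu>\<^sup>(\<^sup>n\<^sup>)\<close>, \<open>X\<^sub>n\<close> for the random walk with this law, \<open>a\<^sub>m\<close> for
  \<open>P\<^bsub>2m\<^esub>(id)\<close> and \<open>H\<^sub>n\<close> for the entropy of \<open>\<mu>\<^sup>(\<^sup>n\<^sup>)\<close>. The return probabilities enter only through a
  sublinear bound on \<open>H\<^sub>n\<close> along a subsequence, and sublinear entropy forces bounded harmonic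
  functions to be constant.

  \<^bold>\<open>From return probabilities to entropy.\<close> By symmetry \<open>E P\<^bsub>2m\<^esub>(X\<^bsub>2k\<^esub>) = a\<^bsub>m+k\<^esub>\<close>, while
  \<open>P\<^bsub>2m\<^esub> \<le> a\<^sub>m\<close> everywhere. So if \<open>a\<close> loses only a factor \<open>exp(-\<delta>)\<close> between \<open>m\<close> and \<open>m + k\<close>, then
  \<open>f = P\<^bsub>2m\<^esub> / a\<^sub>m\<close> is a function with values in \<open>[0, 1]\<close> whose mean at time \<open>2k\<close> is almost \<open>1\<close>. If
  moreover \<open>a\<^sub>m \<ge> exp(-\<delta>k)\<close>, then \<open>f\<close> lives essentially on \<open>exp(\<delta>k)\<close> points, and the part of
  \<open>H\<^bsub>2k\<^esub>\<close> weighted by \<open>f\<close> is at most \<open>\<delta>k + 2\<close>. The part weighted by \<open>1 - f\<close> is small compared to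
  \<open>k\<close> by uniform integrability: the information of \<open>X\<^sub>n\<close> is at most the sum of the informations of
  its \<open>n\<close> increments, which are identically distributed with finite mean. A suitable \<open>m\<close> exists for
  every large \<open>k\<close>: split \<open>[0, k\<^sup>2]\<close> into \<open>k\<close> blocks of length \<open>k\<close>. The total decay of \<open>a\<close> is at
  most a factor \<open>exp(-\<gamma>(k\<^sup>2))\<close> and \<open>\<gamma>(k\<^sup>2) / k\<close> tends to \<open>0\<close>, so some block loses at most
  \<open>exp(-\<delta>)\<close>. This is where the square root comes from: the number of blocks and their length
  both have to dominate \<open>\<gamma>\<close>.

  \<^bold>\<open>From entropy to harmonic functions.\<close> The difference \<open>H\<^bsub>n+1\<^esub> - H\<^sub>n\<close> is the mutual information of
  the first step and the position at time \<open>n + 1\<close>. A harmonic function \<open>h\<close> turns the dependence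
  between these two variables into the variance of \<open>h\<close> under \<open>\<mu>\<close>, so by the Gibbs variational
  inequality this variance is controlled by the increment. As the increments sum to \<open>H\<^sub>n\<close>, sublinear
  growth along a subsequence makes some of them arbitrarily small. Hence \<open>h\<close> agrees with \<open>h(id)\<close> on
  the support of \<open>\<mu>\<close>, and by translation it is constant on the group that the support generates.

  The lemmas that carry the argument are \<open>gibbs_variational_inequality\<close>, \<open>weighted_information_le\<close>,
  \<open>harmonic_variance_le\<close>, \<open>exists_slow_decay_block\<close> and \<open>expected_information_le_of_slow_decay\<close>.
\<close>

section \<open>Integration against discrete distributions\<close>

lemma integrable_bounded_pmf:
  fixes f :: "'a \<Rightarrow> real" and p :: "'a pmf"
  assumes "\<And>x. \<bar>f x\<bar> \<le> B"
  shows "integrable (measure_pmf p) f"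
  using assms by (intro measure_pmf.integrable_const_bound[where B = B]) auto

text \<open>
  Fubini's theorem for bounded functions, reduced to the nonnegative case by adding the bound.
\<close>

lemma expectation_pair_pmf_bounded:
  fixes f :: "'a \<times> 'b \<Rightarrow> real" and p :: "'a pmf" and q :: "'b pmf"
  assumes bdd: "\<And>z. \<bar>f z\<bar> \<le> B"
  shows "measure_pmf.expectation (pair_pmf p q) f
       = measure_pmf.expectation p (\<lambda>a. measure_pmf.expectation q (\<lambda>b. f (a, b)))"
proof -
  note int = integrable_bounded_pmf[where B = B] and int' = integrable_bounded_pmf[where B = "2 * B"]
  have B: "0 \<le> B + f z" "B + f z \<le> 2 * B" for z
    using bdd[of z] by linarith+
  have inner: "0 \<le> measure_pmf.expectation q (\<lambda>b. B + f (a, b))"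
    "measure_pmf.expectation q (\<lambda>b. B + f (a, b)) \<le> 2 * B" for a
    using B by (auto intro!: integral_nonneg_AE measure_pmf.integral_le_const int')
  have "ennreal (measure_pmf.expectation (pair_pmf p q) (\<lambda>z. B + f z))
      = (\<integral>\<^sup>+z. ennreal (B + f z) \<partial>pair_pmf p q)"
    using B by (intro nn_integral_eq_integral[symmetric] int') auto
  also have "\<dots> = (\<integral>\<^sup>+a. \<integral>\<^sup>+b. ennreal (B + f (a, b)) \<partial>q \<partial>p)"
    by (rule nn_integral_pair_pmf')
  also have "\<dots> = (\<integral>\<^sup>+a. ennreal (measure_pmf.expectation q (\<lambda>b. B + f (a, b))) \<partial>p)"
    using B by (intro nn_integral_cong nn_integral_eq_integral int') auto
  also have "\<dots> = ennreal (measure_pmf.expectation p (\<lambda>a. measure_pmf.expectation q (\<lambda>b. B + f (a, b))))"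
    using inner by (intro nn_integral_eq_integral int') auto
  finally have "measure_pmf.expectation (pair_pmf p q) (\<lambda>z. B + f z)
      = measure_pmf.expectation p (\<lambda>a. measure_pmf.expectation q (\<lambda>b. B + f (a, b)))"
    using B inner by (subst (asm) ennreal_inj) (auto intro!: integral_nonneg_AE)
  moreover have "measure_pmf.expectation (pair_pmf p q) (\<lambda>z. B + f z)
      = B + measure_pmf.expectation (pair_pmf p q) f"
    using bdd by (subst Bochner_Integration.integral_add) (auto intro: int)
  moreover have "measure_pmf.expectation q (\<lambda>b. B + f (a, b))
      = B + measure_pmf.expectation q (\<lambda>b. f (a, b))" for a
    using bdd by (subst Bochner_Integration.integral_add) (auto intro: int)
  moreover have "\<bar>measure_pmf.expectation q (\<lambda>b. f (a, b))\<bar> \<le> B" for a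
    using bdd B inner[of a] calculation(3)[of a] by linarith
  then have "measure_pmf.expectation p (\<lambda>a. B + measure_pmf.expectation q (\<lambda>b. f (a, b)))
      = B + measure_pmf.expectation p (\<lambda>a. measure_pmf.expectation q (\<lambda>b. f (a, b)))"
    by (subst Bochner_Integration.integral_add) (auto intro: int)
  ultimately show ?thesis by simp
qed

text \<open>
  The ratio of the mass functions is the density of the part of \<open>q\<close> that is carried by the support of
  \<open>p\<close>, so mass can only be lost.
\<close>

lemma nn_integral_pmf_ratio_le:
  fixes g :: "'a \<Rightarrow> ennreal" and p q :: "'a pmf"
  shows "(\<integral>\<^sup>+y. ennreal (pmf q y / pmf p y) * g y \<partial>p) \<le> (\<integral>\<^sup>+y. g y \<partial>q)"
proof -
  have "(\<integral>\<^sup>+y. ennreal (pmf q y / pmf p y) * g y \<partial>p)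
      = (\<integral>\<^sup>+y. ennreal (pmf p y) * (ennreal (pmf q y / pmf p y) * g y) \<partial>count_space UNIV)"
    by (rule nn_integral_measure_pmf)
  also have "\<dots> \<le> (\<integral>\<^sup>+y. ennreal (pmf q y) * g y \<partial>count_space UNIV)"
  proof (rule nn_integral_mono)
    fix y
    have "ennreal (pmf p y) * ennreal (pmf q y / pmf p y) \<le> ennreal (pmf q y)"
      by (cases "pmf p y = 0") (auto simp: ennreal_mult[symmetric])
    then show "ennreal (pmf p y) * (ennreal (pmf q y / pmf p y) * g y) \<le> ennreal (pmf q y) * g y"
      by (simp add: mult.assoc[symmetric] mult_right_mono)
  qed
  also have "\<dots> = (\<integral>\<^sup>+y. g y \<partial>q)"
    by (rule nn_integral_measure_pmf[symmetric])
  finally show ?thesis .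
qed

text \<open>
  The relative entropy of \<open>p\<close> with respect to \<open>q\<close> bounds how differently a test function \<open>u\<close> can behave
  under the two distributions. The linearised form, with \<open>E exp u - 1\<close> in place of \<open>ln (E exp u)\<close>,
  is a pointwise consequence of \<open>1 + s \<le> exp s\<close> with \<open>s = u - ln (p / q)\<close>.
\<close>

lemma gibbs_variational_inequality:
  fixes u :: "'a \<Rightarrow> real" and p q :: "'a pmf"
  assumes bdd: "\<And>y. \<bar>u y\<bar> \<le> B"
    and ac: "set_pmf p \<subseteq> set_pmf q"
    and int: "integrable (measure_pmf p) (\<lambda>y. ln (pmf p y / pmf q y))"
  shows "measure_pmf.expectation p u
       \<le> measure_pmf.expectation p (\<lambda>y. ln (pmf p y / pmf q y))
         + measure_pmf.expectation q (\<lambda>y. exp (u y)) - 1"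
proof -
  let ?r = "\<lambda>y. pmf q y / pmf p y * exp (u y)"
  have int_exp: "integrable (measure_pmf q) (\<lambda>y. exp (u y))"
    using bdd by (intro measure_pmf.integrable_const_bound[where B = "exp B"]) (auto simp: abs_le_iff)
  have int_u: "integrable (measure_pmf p) u"
    using bdd by (rule integrable_bounded_pmf)
  have "(\<integral>\<^sup>+y. ennreal (?r y) \<partial>p) = (\<integral>\<^sup>+y. ennreal (pmf q y / pmf p y) * ennreal (exp (u y)) \<partial>p)"
    by (intro nn_integral_cong) (simp add: ennreal_mult[symmetric])
  also have "\<dots> \<le> (\<integral>\<^sup>+y. ennreal (exp (u y)) \<partial>q)"
    by (rule nn_integral_pmf_ratio_le)
  also have "\<dots> = ennreal (measure_pmf.expectation q (\<lambda>y. exp (u y)))"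
    using int_exp by (intro nn_integral_eq_integral) auto
  finally have le: "(\<integral>\<^sup>+y. ennreal (?r y) \<partial>p) \<le> ennreal (measure_pmf.expectation q (\<lambda>y. exp (u y)))" .
  then have int_r: "integrable (measure_pmf p) ?r"
    by (intro integrableI_bounded) (auto simp: abs_mult intro: le_less_trans)
  have "ennreal (measure_pmf.expectation p ?r) = (\<integral>\<^sup>+y. ennreal (?r y) \<partial>p)"
    using int_r by (intro nn_integral_eq_integral[symmetric]) auto
  then have "ennreal (measure_pmf.expectation p ?r) \<le> ennreal (measure_pmf.expectation q (\<lambda>y. exp (u y)))"
    using le by (simp only:)
  then have E_r: "measure_pmf.expectation p ?r \<le> measure_pmf.expectation q (\<lambda>y. exp (u y))"
    by (subst (asm) ennreal_le_iff) (auto intro: integral_nonneg_AE)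
  have "measure_pmf.expectation p u
      \<le> measure_pmf.expectation p (\<lambda>y. ln (pmf p y / pmf q y) + ?r y - 1)"
  proof (rule integral_mono_AE)
    show "AE y in p. u y \<le> ln (pmf p y / pmf q y) + ?r y - 1"
    proof (rule AE_pmfI)
      fix y assume y: "y \<in> set_pmf p"
      then have pos: "pmf p y > 0" "pmf q y > 0"
        using ac by (auto simp: pmf_positive)
      have "1 + (u y - ln (pmf p y / pmf q y)) \<le> exp (u y - ln (pmf p y / pmf q y))"
        by (rule exp_ge_add_one_self)
      also have "\<dots> = ?r y"
        using pos by (simp add: exp_diff exp_ln)
      finally show "u y \<le> ln (pmf p y / pmf q y) + ?r y - 1" by simp
    qed
  qed (use int int_r int_u in auto)
  also have "\<dots> = measure_pmf.expectation p (\<lambda>y. ln (pmf p y / pmf q y)) + measure_pmf.expectation p ?r - 1"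
    using int int_r by simp
  finally show ?thesis using E_r by linarith
qed

lemma exp_le_quadratic:
  fixes x :: real
  assumes "\<bar>x\<bar> \<le> 1"
  shows "exp x \<le> 1 + x + x\<^sup>2"
proof (cases "0 \<le> x")
  case True
  then show ?thesis using assms by (intro exp_bound) auto
next
  case False
  define y where "y = - x"
  have y: "0 \<le> y" "y \<le> 1" using False assms by (auto simp: y_def)
  have "1 \<le> 1 + (y\<^sup>2 + y ^ 3 + y ^ 4) / 2"
    using y by simp
  also have "\<dots> = (1 - y + y\<^sup>2) * (1 + y + y\<^sup>2 / 2)"
    by (simp add: field_simps power2_eq_square power3_eq_cube power4_eq_xxxx)
  also have "\<dots> \<le> (1 - y + y\<^sup>2) * exp y"
    using y by (intro mult_left_mono exp_lower_Taylor_quadratic) auto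
  finally have "1 * exp x \<le> ((1 - y + y\<^sup>2) * exp y) * exp x"
    by (rule mult_right_mono) simp
  then show ?thesis by (simp add: y_def mult.assoc flip: exp_add)
qed

text \<open>
  Uniform integrability of a single integrable function; values of \<open>f x - M\<close> below \<open>0\<close> are truncated by
  \<^const>\<open>ennreal\<close>.
\<close>

lemma nn_integral_excess_tendsto_0:
  fixes f :: "'a \<Rightarrow> real"
  assumes "(\<integral>\<^sup>+x. ennreal (f x) \<partial>measure_pmf p) < \<infinity>"
  shows "(\<lambda>M::nat. \<integral>\<^sup>+x. ennreal (f x - real M) \<partial>measure_pmf p) \<longlonglongrightarrow> 0"
proof -
  have "(\<lambda>M::nat. \<integral>\<^sup>+x. ennreal (f x - real M) \<partial>measure_pmf p) \<longlonglongrightarrow> (\<integral>\<^sup>+x. 0 \<partial>measure_pmf p)"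
  proof (rule nn_integral_dominated_convergence[where w = "\<lambda>x. ennreal (f x)"])
    show "AE x in p. (\<lambda>M::nat. ennreal (f x - real M)) \<longlonglongrightarrow> 0"
    proof (rule AE_I2, rule tendsto_eventually)
      fix x
      obtain N :: nat where "f x \<le> real N" using real_arch_simple by blast
      then have "ennreal (f x - real M) = 0" if "M \<ge> N" for M
        using that by (intro ennreal_neg) simp
      then show "\<forall>\<^sub>F M in sequentially. ennreal (f x - real M) = 0"
        by (auto simp: eventually_sequentially)
    qed
  qed (use assms in \<open>auto intro!: ennreal_leI\<close>)
  then show ?thesis by simp
qed

section \<open>Entropy as an expected information content\<close>

text \<open>
  This is the entropy of \<open>p\<close>, written as an integral against \<open>p\<close> itself so that it can be transported
  along convolutions. The value may be infinite.
\<close>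

definition expected_information :: "'a pmf \<Rightarrow> ennreal" where
  "expected_information p = (\<integral>\<^sup>+x. ennreal (- ln (pmf p x)) \<partial>p)"

lemma neg_ln_pmf_nonneg: "0 \<le> - ln (pmf p x)"
  by (cases "pmf p x = 0") (auto simp: pmf_le_1 pmf_nonneg less_le)

lemma finite_shannon_entropyD:
  assumes supp: "set_pmf p \<subseteq> carrier G" and fin: "shannon_entropy G p < \<infinity>"
  shows "expected_information p < \<infinity>"
proof -
  let ?g = "\<lambda>x. - (pmf p x * ln (pmf p x))"
  have g: "0 \<le> ?g x" for x
    using mult_nonneg_nonneg[OF pmf_nonneg neg_ln_pmf_nonneg, of p x p x] by simp
  define I where "I = shannon_entropy G p"
  have bound: "sum ?g F \<le> enn2real I" if F: "finite F" "F \<subseteq> carrier G" for F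
  proof -
    have "ennreal (sum ?g F) = (\<Sum>x\<in>F. ennreal (?g x))"
      using g by (simp add: sum_ennreal)
    also have "\<dots> = (\<Sum>\<^sub>\<infinity>x\<in>F. ennreal (?g x))"
      using F by simp
    also have "\<dots> \<le> I"
      unfolding I_def shannon_entropy_def
      using F by (intro infsum_mono_neutral nonneg_summable_on_complete) auto
    finally have "enn2real (ennreal (sum ?g F)) \<le> enn2real I"
      using fin by (intro enn2real_mono) (auto simp: I_def)
    then show ?thesis
      using g by (simp add: sum_nonneg)
  qed
  have "?g summable_on carrier G"
    using g bound by (intro nonneg_bdd_above_summable_on bdd_aboveI2[where M = "enn2real I"]) auto
  then have "Infinite_Set_Sum.abs_summable_on ?g (carrier G)"
    using g by (subst abs_summable_equivalent[symmetric]) (simp add: summable_on_iff_abs_summable_on_real[symmetric])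
  then have "(\<integral>\<^sup>+x. ennreal (norm (?g x)) \<partial>count_space (carrier G)) < \<infinity>"
    unfolding abs_summable_on_def by (simp add: integrable_iff_bounded)
  moreover have "expected_information p = (\<integral>\<^sup>+x. ennreal (norm (?g x)) \<partial>count_space (carrier G))"
  proof -
    have "expected_information p = (\<integral>\<^sup>+x. ennreal (pmf p x) * ennreal (- ln (pmf p x)) \<partial>count_space UNIV)"
      unfolding expected_information_def by (rule nn_integral_measure_pmf)
    also have "\<dots> = (\<integral>\<^sup>+x. ennreal (norm (?g x)) * indicator (carrier G) x \<partial>count_space UNIV)"
    proof (rule nn_integral_cong)
      fix x
      have "ennreal (pmf p x) * ennreal (- ln (pmf p x)) = ennreal (norm (?g x))"
        using g[of x] neg_ln_pmf_nonneg[of p x] by (simp add: ennreal_mult[symmetric])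
      moreover have "pmf p x = 0" if "x \<notin> carrier G"
        using that supp by (auto simp: set_pmf_iff)
      ultimately show "ennreal (pmf p x) * ennreal (- ln (pmf p x))
          = ennreal (norm (?g x)) * indicator (carrier G) x"
        by (auto simp: indicator_def)
    qed
    also have "\<dots> = (\<integral>\<^sup>+x. ennreal (norm (?g x)) \<partial>count_space (carrier G))"
      by (simp add: nn_integral_count_space_indicator)
    finally show ?thesis .
  qed
  ultimately show ?thesis by simp
qed

lemma integrable_ln_pmf:
  assumes "expected_information p < \<infinity>"
  shows "integrable (measure_pmf p) (\<lambda>x. ln (pmf p x))"
proof (rule integrableI_bounded)
  have "norm (ln (pmf p x)) = - ln (pmf p x)" for x
    using neg_ln_pmf_nonneg[of p x] by simp
  then show "(\<integral>\<^sup>+x. ennreal (norm (ln (pmf p x))) \<partial>p) < \<infinity>"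
    using assms by (simp add: expected_information_def)
qed simp

section \<open>Convolution powers\<close>

locale random_walk = group G for G (structure) +
  fixes \<mu> :: "'a pmf"
  assumes supp: "set_pmf \<mu> \<subseteq> carrier G"
begin

abbreviation law :: "nat \<Rightarrow> 'a pmf" where
  "law n \<equiv> convolution_power G \<mu> n"

abbreviation info :: "nat \<Rightarrow> 'a \<Rightarrow> real" where
  "info n x \<equiv> - ln (pmf (law n) x)"

lemma set_convolution_pmf:
  "set_pmf (convolution_pmf G p q) = (\<lambda>(x, y). x \<otimes> y) ` (set_pmf p \<times> set_pmf q)"
  by (simp add: convolution_pmf_def)

lemma supp_law: "set_pmf (law n) \<subseteq> carrier G"
  using supp by (induction n) (auto simp: set_convolution_pmf)

lemma nn_integral_convolution:
  "(\<integral>\<^sup>+z. f z \<partial>convolution_pmf G p q) = (\<integral>\<^sup>+x. \<integral>\<^sup>+y. f (x \<otimes> y) \<partial>q \<partial>p)"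
  by (simp add: convolution_pmf_def nn_integral_pair_pmf')

lemma convolution_assoc:
  assumes "set_pmf p \<subseteq> carrier G" "set_pmf q \<subseteq> carrier G" "set_pmf r \<subseteq> carrier G"
  shows "convolution_pmf G (convolution_pmf G p q) r = convolution_pmf G p (convolution_pmf G q r)"
proof -
  have conv: "convolution_pmf G a b = bind_pmf a (\<lambda>x. bind_pmf b (\<lambda>y. return_pmf (x \<otimes> y)))" for a b
    by (simp add: convolution_pmf_def pair_pmf_def map_bind_pmf)
  show ?thesis
    unfolding conv bind_assoc_pmf bind_return_pmf
    using assms by (intro bind_pmf_cong refl) (simp_all add: subset_iff m_assoc)
qed

lemma convolution_one:
  assumes "set_pmf p \<subseteq> carrier G"
  shows "convolution_pmf G (return_pmf \<one>) p = p" "convolution_pmf G p (return_pmf \<one>) = p"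
proof -
  have "map_pmf (\<lambda>x. \<one> \<otimes> x) p = map_pmf (\<lambda>x. x) p" "map_pmf (\<lambda>x. x \<otimes> \<one>) p = map_pmf (\<lambda>x. x) p"
    by (rule map_pmf_cong[OF refl], use assms in \<open>simp add: subset_iff\<close>)+
  then show "convolution_pmf G (return_pmf \<one>) p = p" "convolution_pmf G p (return_pmf \<one>) = p"
    by (simp_all add: convolution_pmf_def pair_return_pmf1 pair_return_pmf2 map_pmf_comp)
qed

lemma law_add: "law (m + n) = convolution_pmf G (law m) (law n)"
proof (induction n)
  case 0
  show ?case using convolution_one(2)[OF supp_law] by simp
next
  case (Suc n)
  then show ?case using convolution_assoc[OF supp_law supp_law supp, of m n] by simp
qed

lemma law_Suc_left: "law (Suc n) = convolution_pmf G \<mu> (law n)"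
  using law_add[of 1 n] convolution_one(1)[OF supp] by simp

lemma law_Suc_0: "law (Suc 0) = \<mu>"
  using convolution_one(1)[OF supp] by simp

text \<open>
  The first factor is integrated out: given \<open>x\<close>, the product equals \<open>g\<close> exactly if the second factor
  is \<open>x\<^sup>-\<^sup>1 g\<close>.
\<close>

lemma pmf_convolution:
  assumes "set_pmf p \<subseteq> carrier G" "set_pmf q \<subseteq> carrier G" "g \<in> carrier G"
  shows "ennreal (pmf (convolution_pmf G p q) g) = (\<integral>\<^sup>+x. ennreal (pmf q (inv x \<otimes> g)) \<partial>p)"
proof -
  have "ennreal (pmf (convolution_pmf G p q) g)
      = (\<integral>\<^sup>+x. \<integral>\<^sup>+y. indicator {g} (x \<otimes> y) \<partial>q \<partial>p)"
    unfolding nn_integral_convolution[symmetric] by (simp add: emeasure_pmf_single)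
  also have "\<dots> = (\<integral>\<^sup>+x. ennreal (pmf q (inv x \<otimes> g)) \<partial>p)"
  proof (intro nn_integral_cong_AE AE_pmfI)
    fix x assume "x \<in> set_pmf p"
    then have x: "x \<in> carrier G" using assms by auto
    have "(\<integral>\<^sup>+y. indicator {g} (x \<otimes> y) \<partial>q) = (\<integral>\<^sup>+y. indicator {inv x \<otimes> g} y \<partial>q)"
    proof (intro nn_integral_cong_AE AE_pmfI)
      fix y assume "y \<in> set_pmf q"
      then have y: "y \<in> carrier G" using assms by auto
      have "x \<otimes> y = g \<longleftrightarrow> y = inv x \<otimes> g"
        using x y assms(3) by (auto simp: m_assoc[symmetric])
      then show "(indicator {g} (x \<otimes> y) :: ennreal) = indicator {inv x \<otimes> g} y"
        by (auto simp: indicator_def)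
    qed
    then show "(\<integral>\<^sup>+y. indicator {g} (x \<otimes> y) \<partial>q) = ennreal (pmf q (inv x \<otimes> g))"
      by (simp add: emeasure_pmf_single)
  qed
  finally show ?thesis .
qed

lemma law_mult_le:
  assumes "x \<in> carrier G" "y \<in> carrier G"
  shows "pmf (law m) x * pmf (law n) y \<le> pmf (law (m + n)) (x \<otimes> y)"
proof -
  have "pmf (law m) x * pmf (law n) y = measure (pair_pmf (law m) (law n)) {(x, y)}"
    by (simp add: pmf_pair measure_pmf_single)
  also have "\<dots> \<le> measure (pair_pmf (law m) (law n)) ((\<lambda>(x, y). x \<otimes> y) -` {x \<otimes> y})"
    by (intro measure_pmf.finite_measure_mono) auto
  also have "\<dots> = pmf (law (m + n)) (x \<otimes> y)"
    by (simp add: law_add convolution_pmf_def pmf_map)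
  finally show ?thesis .
qed

section \<open>Growth of the entropy\<close>

text \<open>
  Subadditivity of information: one way to reach \<open>z y\<close> at time \<open>n + 1\<close> is through \<open>z\<close> at time \<open>n\<close>.
\<close>

lemma info_product_le:
  assumes "z \<in> set_pmf (law n)" "y \<in> set_pmf \<mu>"
  shows "info (Suc n) (z \<otimes> y) \<le> info n z + - ln (pmf \<mu> y)"
proof -
  have pos: "pmf (law n) z > 0" "pmf \<mu> y > 0" using assms by (auto simp: pmf_positive)
  have "pmf (law n) z * pmf \<mu> y \<le> pmf (law (Suc n)) (z \<otimes> y)"
    using law_mult_le[of z y n "Suc 0"] assms supp supp_law[of n]
    by (auto simp: law_Suc_0 simp del: convolution_power.simps)
  with pos have "ln (pmf (law n) z * pmf \<mu> y) \<le> info (Suc n) (z \<otimes> y) * (-1)"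
    by (subst mult_minus1_right, simp only: minus_minus) (rule ln_mono, auto)
  with pos show ?thesis by (simp add: ln_mult)
qed

text \<open>
  If \<open>w\<close> has small mean, then it sees only a small part of the entropy, at a linear rate in \<open>n\<close>. The
  information of the last step exceeds \<open>M\<close> by an amount whose mean is the tail integral, and up to \<open>M\<close>
  it is charged to the mean of \<open>w\<close>. The information of the earlier steps is handled by the induction
  hypothesis for the conditional mean of \<open>w\<close> given the position at time \<open>n\<close>, whose mean is that of \<open>w\<close>;
  this is why the statement is about all weights at once. With \<open>w = 1\<close> and \<open>M = 0\<close> it is the
  subadditivity of entropy.
\<close>

lemma weighted_information_le:
  fixes w :: "'a \<Rightarrow> ennreal"
  assumes "\<And>x. w x \<le> 1"
  shows "(\<integral>\<^sup>+x. w x * ennreal (info n x) \<partial>law n)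
    \<le> of_nat n * ((\<integral>\<^sup>+x. ennreal (- ln (pmf \<mu> x) - real M) \<partial>\<mu>) + of_nat M * (\<integral>\<^sup>+x. w x \<partial>law n))"
    (is "_ \<le> of_nat n * (?T + of_nat M * _)")
  using assms
proof (induction n arbitrary: w)
  case 0
  then show ?case by simp
next
  case (Suc n)
  let ?w = "\<lambda>z. \<integral>\<^sup>+y. w (z \<otimes> y) \<partial>\<mu>"
  let ?W = "\<integral>\<^sup>+x. w x \<partial>law (Suc n)"
  have W: "(\<integral>\<^sup>+z. ?w z \<partial>law n) = ?W"
    by (simp add: nn_integral_convolution)
  have "?w z \<le> (\<integral>\<^sup>+y. 1 \<partial>\<mu>)" for z
    using Suc.prems by (intro nn_integral_mono)
  then have w1: "?w z \<le> 1" for z by simp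
  have "(\<integral>\<^sup>+x. w x * ennreal (info (Suc n) x) \<partial>law (Suc n))
      = (\<integral>\<^sup>+z. \<integral>\<^sup>+y. w (z \<otimes> y) * ennreal (info (Suc n) (z \<otimes> y)) \<partial>\<mu> \<partial>law n)"
    by (simp add: nn_integral_convolution)
  also have "\<dots> \<le> (\<integral>\<^sup>+z. \<integral>\<^sup>+y. w (z \<otimes> y) * ennreal (info n z)
      + (ennreal (- ln (pmf \<mu> y) - real M) + of_nat M * w (z \<otimes> y)) \<partial>\<mu> \<partial>law n)"
  proof (intro nn_integral_mono_AE AE_pmfI)
    fix z y assume zy: "z \<in> set_pmf (law n)" "y \<in> set_pmf \<mu>"
    have "ennreal (info (Suc n) (z \<otimes> y))
        \<le> ennreal (info n z + (max 0 (- ln (pmf \<mu> y) - real M) + real M))"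
      using info_product_le[OF zy] by (intro ennreal_leI) linarith
    also have "\<dots> = ennreal (info n z) + (ennreal (- ln (pmf \<mu> y) - real M) + of_nat M)"
      using neg_ln_pmf_nonneg[of "law n" z] by (subst ennreal_plus, simp, simp)
        (simp add: ennreal_plus max_def ennreal_neg ennreal_of_nat_eq_real_of_nat)
    finally have "w (z \<otimes> y) * ennreal (info (Suc n) (z \<otimes> y))
        \<le> w (z \<otimes> y) * (ennreal (info n z) + (ennreal (- ln (pmf \<mu> y) - real M) + of_nat M))"
      by (rule mult_left_mono) simp
    also have "\<dots> = w (z \<otimes> y) * ennreal (info n z)
        + (w (z \<otimes> y) * ennreal (- ln (pmf \<mu> y) - real M) + of_nat M * w (z \<otimes> y))"
      by (simp add: distrib_left mult.commute)
    also have "\<dots> \<le> w (z \<otimes> y) * ennreal (info n z)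
        + (1 * ennreal (- ln (pmf \<mu> y) - real M) + of_nat M * w (z \<otimes> y))"
      using Suc.prems by (intro add_mono mult_right_mono) auto
    finally show "w (z \<otimes> y) * ennreal (info (Suc n) (z \<otimes> y))
        \<le> w (z \<otimes> y) * ennreal (info n z)
          + (ennreal (- ln (pmf \<mu> y) - real M) + of_nat M * w (z \<otimes> y))" by simp
  qed
  also have "\<dots> = (\<integral>\<^sup>+z. ?w z * ennreal (info n z) \<partial>law n) + (?T + of_nat M * ?W)"
    by (simp add: nn_integral_add nn_integral_cmult nn_integral_multc W[symmetric]
      del: convolution_power.simps)
  also have "\<dots> \<le> of_nat n * (?T + of_nat M * (\<integral>\<^sup>+z. ?w z \<partial>law n)) + (?T + of_nat M * ?W)"
    by (intro add_mono Suc.IH w1) simp_all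
  also have "\<dots> = of_nat (Suc n) * (?T + of_nat M * ?W)"
    unfolding W by (simp add: distrib_right add.commute)
  finally show ?case .
qed

lemma expected_information_law_finite:
  assumes "expected_information \<mu> < \<infinity>"
  shows "expected_information (law n) < \<infinity>"
proof -
  have "expected_information (law n) \<le> of_nat n * expected_information \<mu>"
    using weighted_information_le[of "\<lambda>_. 1" n 0] by (simp add: expected_information_def)
  also have "\<dots> < \<infinity>"
    using assms by (simp add: ennreal_mult_less_top of_nat_less_top)
  finally show ?thesis .
qed


section \<open>Entropy increments control harmonic functions\<close>

definition entropy :: "nat \<Rightarrow> real" where
  "entropy n = measure_pmf.expectation (law n) (info n)"

lemma ennreal_entropy:
  assumes "expected_information \<mu> < \<infinity>"
  shows "ennreal (entropy n) = expected_information (law n)"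
  unfolding entropy_def expected_information_def
proof (rule nn_integral_eq_integral[symmetric])
  show "integrable (measure_pmf (law n)) (info n)"
    using integrable_ln_pmf[OF expected_information_law_finite[OF assms]] by simp
  show "AE x in law n. 0 \<le> info n x"
    by (rule AE_I2) (rule neg_ln_pmf_nonneg)
qed

lemma entropy_0: "entropy 0 = 0"
  by (simp add: entropy_def)

lemma harmonic_expectation:
  assumes h: "harmonic G \<mu> h" and x: "x \<in> carrier G"
  shows "measure_pmf.expectation \<mu> (\<lambda>y. h (x \<otimes> y)) = h x"
proof -
  have "((\<lambda>y. h (x \<otimes> y) * pmf \<mu> y) has_sum h x) (carrier G)"
    using h x by (auto simp: harmonic_def)
  moreover have "h (x \<otimes> y) * pmf \<mu> y = 0" if "y \<notin> carrier G" for y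
    using that supp by (auto simp: set_pmf_iff)
  ultimately have sum: "((\<lambda>y. pmf \<mu> y * h (x \<otimes> y)) has_sum h x) UNIV"
    by (subst has_sum_cong_neutral[where T = "carrier G" and g = "\<lambda>y. h (x \<otimes> y) * pmf \<mu> y"])
       (auto simp: mult.commute)
  have "(\<lambda>y. pmf \<mu> y * h (x \<otimes> y)) summable_on UNIV"
    by (rule has_sum_imp_summable[OF sum])
  then have "Infinite_Set_Sum.abs_summable_on (\<lambda>y. pmf \<mu> y * h (x \<otimes> y)) UNIV"
    by (rule abs_summable_equivalent[THEN iffD1, OF summable_on_iff_abs_summable_on_real[THEN iffD1]])
  then show ?thesis
    using sum by (simp add: pmf_expectation_eq_infsetsum infsetsum_infsum infsumI)
qed

lemma harmonic_expectation_law: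
  assumes h: "harmonic G \<mu> h" and bdd: "\<And>x. \<bar>h x\<bar> \<le> B" and x: "x \<in> carrier G"
  shows "measure_pmf.expectation (law n) (\<lambda>y. h (x \<otimes> y)) = h x"
proof (induction n)
  case 0
  show ?case using x by simp
next
  case (Suc n)
  have "measure_pmf.expectation (law (Suc n)) (\<lambda>y. h (x \<otimes> y))
      = measure_pmf.expectation (pair_pmf (law n) \<mu>) (\<lambda>p. h (x \<otimes> (fst p \<otimes> snd p)))"
    by (simp add: convolution_pmf_def case_prod_beta)
  also have "\<dots> = measure_pmf.expectation (law n)
      (\<lambda>z. measure_pmf.expectation \<mu> (\<lambda>y. h (x \<otimes> (z \<otimes> y))))"
    using bdd by (subst expectation_pair_pmf_bounded[where B = B]) auto
  also have "\<dots> = measure_pmf.expectation (law n) (\<lambda>z. h (x \<otimes> z))"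
  proof (intro integral_cong_AE AE_pmfI)
    fix z assume "z \<in> set_pmf (law n)"
    then have z: "z \<in> carrier G" using supp_law by blast
    have "measure_pmf.expectation \<mu> (\<lambda>y. h (x \<otimes> (z \<otimes> y)))
        = measure_pmf.expectation \<mu> (\<lambda>y. h (x \<otimes> z \<otimes> y))"
      using x z supp by (intro integral_cong_AE AE_pmfI) (auto simp: m_assoc subset_iff)
    also have "\<dots> = h (x \<otimes> z)"
      using x z by (intro harmonic_expectation[OF h]) auto
    finally show "measure_pmf.expectation \<mu> (\<lambda>y. h (x \<otimes> (z \<otimes> y))) = h (x \<otimes> z)" .
  qed simp_all
  finally show ?case using Suc.IH by simp
qed

text \<open>
  The joint law of the first step and the position at time \<open>n + 1\<close>. The random walk multiplies new steps
  on the right, whereas here \<open>n\<close> steps follow a given first one, so the new factor stands on the left.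
\<close>

definition increment_law :: "nat \<Rightarrow> ('a \<times> 'a) pmf" where
  "increment_law n = map_pmf (\<lambda>(x, z). (x, x \<otimes> z)) (pair_pmf \<mu> (law n))"

lemma pmf_increment_law:
  assumes "x \<in> set_pmf \<mu>" "z \<in> set_pmf (law n)"
  shows "pmf (increment_law n) (x, x \<otimes> z) = pmf \<mu> x * pmf (law n) z"
proof -
  let ?f = "\<lambda>(x, z). (x, x \<otimes> z)"
  have "inj_on ?f (set_pmf (pair_pmf \<mu> (law n)))"
    using supp supp_law[of n] by (auto simp: inj_on_def subset_iff)
  then have "pmf (map_pmf ?f (pair_pmf \<mu> (law n))) (?f (x, z)) = pmf (pair_pmf \<mu> (law n)) (x, z)"
    using assms by (intro pmf_map_inj) auto
  then show ?thesis by (simp add: increment_law_def pmf_pair)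
qed

lemma set_increment_law: "set_pmf (increment_law n) \<subseteq> set_pmf (pair_pmf \<mu> (law (Suc n)))"
  by (auto simp: increment_law_def law_Suc_left set_convolution_pmf simp del: convolution_power.simps)

text \<open>
  The relative entropy of the joint law with respect to the product of its marginals is the mutual
  information of the first step and the position. At \<open>(x, x z)\<close> the ratio of masses is
  \<open>P\<^sub>n(z) / P\<^bsub>n+1\<^esub>(x z)\<close>, as the factor \<open>\<mu>(x)\<close> cancels, so its mean logarithm is a difference of two
  entropies.
\<close>

lemma information_increment:
  fixes n :: nat
  assumes fin: "expected_information \<mu> < \<infinity>"
  defines "L \<equiv> \<lambda>e. ln (pmf (increment_law n) e / pmf (pair_pmf \<mu> (law (Suc n))) e)"
  shows "integrable (measure_pmf (increment_law n)) L"
    and "measure_pmf.expectation (increment_law n) L = entropy (Suc n) - entropy n"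
proof -
  let ?P = "pair_pmf \<mu> (law n)"
  have law_prod: "map_pmf (\<lambda>p. fst p \<otimes> snd p) ?P = law (Suc n)"
    by (simp add: law_Suc_left convolution_pmf_def case_prod_beta' del: convolution_power.simps)
  have law_snd: "map_pmf snd ?P = law n"
    by (rule map_snd_pair_pmf)
  have L: "AE p in ?P. L (fst p, fst p \<otimes> snd p) = info (Suc n) (fst p \<otimes> snd p) - info n (snd p)"
  proof (rule AE_pmfI)
    fix p assume p: "p \<in> set_pmf ?P"
    obtain x z where [simp]: "p = (x, z)" by force
    have xz: "x \<in> set_pmf \<mu>" "z \<in> set_pmf (law n)" using p by auto
    then have "x \<otimes> z \<in> set_pmf (law (Suc n))"
      by (auto simp: law_Suc_left set_convolution_pmf simp del: convolution_power.simps)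
    with xz have pos: "pmf \<mu> x > 0" "pmf (law n) z > 0" "pmf (law (Suc n)) (x \<otimes> z) > 0"
      by (auto simp: pmf_positive simp del: convolution_power.simps)
    have "L (x, x \<otimes> z) = ln (pmf (law n) z / pmf (law (Suc n)) (x \<otimes> z))"
      using pos by (simp add: L_def pmf_increment_law[OF xz] pmf_pair del: convolution_power.simps)
    then show "L (fst p, fst p \<otimes> snd p) = info (Suc n) (fst p \<otimes> snd p) - info n (snd p)"
      using pos by (simp add: ln_div del: convolution_power.simps)
  qed
  have int: "integrable (measure_pmf (law m)) (info m)" for m
    using integrable_ln_pmf[OF expected_information_law_finite[OF fin]] by simp
  have int1: "integrable (measure_pmf ?P) (\<lambda>p. info (Suc n) (fst p \<otimes> snd p))"
    by (rule integrable_map_pmf_eq[THEN iffD1]) (unfold law_prod, rule int)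
  have int2: "integrable (measure_pmf ?P) (\<lambda>p. info n (snd p))"
    by (rule integrable_map_pmf_eq[THEN iffD1]) (unfold law_snd, rule int)
  have inc: "increment_law n = map_pmf (\<lambda>p. (fst p, fst p \<otimes> snd p)) ?P"
    by (simp add: increment_law_def case_prod_beta')
  have "integrable (measure_pmf ?P) (\<lambda>p. L (fst p, fst p \<otimes> snd p))"
    using int1 int2 by (subst integrable_cong_AE[OF _ _ L]) simp_all
  then show "integrable (measure_pmf (increment_law n)) L"
    by (simp add: inc)
  have "measure_pmf.expectation (increment_law n) L
      = measure_pmf.expectation ?P (\<lambda>p. L (fst p, fst p \<otimes> snd p))"
    by (simp add: inc)
  also have "\<dots> = measure_pmf.expectation ?P (\<lambda>p. info (Suc n) (fst p \<otimes> snd p) - info n (snd p))"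
    by (rule integral_cong_AE[OF _ _ L]) simp_all
  also have "\<dots> = measure_pmf.expectation ?P (\<lambda>p. info (Suc n) (fst p \<otimes> snd p))
      - measure_pmf.expectation ?P (\<lambda>p. info n (snd p))"
    by (rule Bochner_Integration.integral_diff[OF int1 int2])
  also have "\<dots> = measure_pmf.expectation (map_pmf (\<lambda>p. fst p \<otimes> snd p) ?P) (info (Suc n))
      - measure_pmf.expectation (map_pmf snd ?P) (info n)"
    by (simp only: integral_map_pmf)
  also have "\<dots> = entropy (Suc n) - entropy n"
    by (simp only: law_prod law_snd entropy_def)
  finally show "measure_pmf.expectation (increment_law n) L = entropy (Suc n) - entropy n" .
qed

text \<open>
  The test function \<open>v(x, y) = (h(x) - h(id)) h(y)\<close> detects the dependence of the position \<open>y\<close> on the first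
  step \<open>x\<close>: given \<open>x\<close>, the mean of \<open>h(y)\<close> is \<open>h(x)\<close> under the joint law but \<open>h(id)\<close> under the product
  law. The two means of \<open>v\<close> therefore differ by the second moment of \<open>h - h(id)\<close>. The Gibbs
  inequality is applied to \<open>t v\<close>; the constant \<open>2 B\<^sup>2\<close> bounds \<open>\<bar>v\<bar>\<close>.
\<close>

lemma harmonic_variance_le:
  assumes h: "harmonic G \<mu> h" and bdd: "\<And>x. \<bar>h x\<bar> \<le> B"
    and fin: "expected_information \<mu> < \<infinity>"
    and t: "0 \<le> t" "t * (2 * B\<^sup>2) \<le> 1"
  shows "t * measure_pmf.expectation \<mu> (\<lambda>x. (h x - h \<one>)\<^sup>2)
       \<le> entropy (Suc n) - entropy n + (t * (2 * B\<^sup>2))\<^sup>2"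
proof -
  define C where "C = 2 * B\<^sup>2"
  define v where "v = (\<lambda>e. (h (fst e) - h \<one>) * h (snd e))"
  let ?p = "increment_law n" and ?q = "pair_pmf \<mu> (law (Suc n))"
  have diff: "\<bar>h x - h \<one>\<bar> \<le> 2 * B" for x
    using bdd[of x] bdd[of \<one>] by linarith
  have B: "0 \<le> B" using bdd[of \<one>] by linarith
  have v: "\<bar>v e\<bar> \<le> C" for e
  proof -
    have "\<bar>v e\<bar> \<le> (2 * B) * B"
      unfolding v_def abs_mult using diff bdd B by (intro mult_mono) auto
    then show ?thesis by (simp add: C_def power2_eq_square)
  qed
  have tv: "\<bar>t * v e\<bar> \<le> t * C" for e
    using v[of e] t by (simp add: abs_mult mult_left_mono)
  have exp_tv: "exp (t * v e) \<le> 1 + t * v e + (t * C)\<^sup>2" for e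
  proof -
    have "exp (t * v e) \<le> 1 + t * v e + (t * v e)\<^sup>2"
      using tv[of e] t by (intro exp_le_quadratic) (simp add: C_def)
    also have "(t * v e)\<^sup>2 \<le> (t * C)\<^sup>2"
      using tv[of e] by (intro power2_le_iff_abs_le[THEN iffD2]) auto
    finally show ?thesis by simp
  qed
  have int: "integrable (measure_pmf r) v" for r
    using v by (rule integrable_bounded_pmf)
  have int_exp: "integrable (measure_pmf ?q) (\<lambda>e. exp (t * v e))"
    using tv by (intro integrable_bounded_pmf[where B = "exp (t * C)"]) (auto simp: abs_le_iff)
  have "measure_pmf.expectation ?q (\<lambda>e. exp (t * v e))
      \<le> measure_pmf.expectation ?q (\<lambda>e. 1 + t * v e + (t * C)\<^sup>2)"
    using int int_exp exp_tv by (intro integral_mono) auto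
  also have "\<dots> = 1 + t * measure_pmf.expectation ?q v + (t * C)\<^sup>2"
    using int by simp
  finally have "t * measure_pmf.expectation ?p v
      \<le> entropy (Suc n) - entropy n + t * measure_pmf.expectation ?q v + (t * C)\<^sup>2"
    using gibbs_variational_inequality[where u = "\<lambda>e. t * v e", OF tv set_increment_law information_increment(1)[OF fin], of n]
      information_increment(2)[OF fin, of n] by simp
  moreover have "measure_pmf.expectation ?p v = measure_pmf.expectation \<mu> (\<lambda>x. (h x - h \<one>) * h x)"
  proof -
    have "measure_pmf.expectation ?p v
        = measure_pmf.expectation (pair_pmf \<mu> (law n)) (\<lambda>p. v (fst p, fst p \<otimes> snd p))"
      by (simp add: increment_law_def case_prod_beta')
    also have "\<dots> = measure_pmf.expectation \<mu>
        (\<lambda>x. measure_pmf.expectation (law n) (\<lambda>z. v (x, x \<otimes> z)))"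
      using v by (subst expectation_pair_pmf_bounded[where B = C]) auto
    also have "\<dots> = measure_pmf.expectation \<mu> (\<lambda>x. (h x - h \<one>) * h x)"
      using supp by (intro integral_cong_AE AE_pmfI)
        (auto simp: v_def harmonic_expectation_law[OF h bdd] subset_iff)
    finally show ?thesis .
  qed
  moreover have "measure_pmf.expectation ?q v = measure_pmf.expectation \<mu> (\<lambda>x. (h x - h \<one>) * h \<one>)"
  proof -
    have "measure_pmf.expectation (law (Suc n)) h
        = measure_pmf.expectation (law (Suc n)) (\<lambda>z. h (\<one> \<otimes> z))"
      using supp_law[of "Suc n"] by (intro integral_cong_AE AE_pmfI) (auto simp: subset_iff)
    then have "measure_pmf.expectation (law (Suc n)) h = h \<one>"
      using harmonic_expectation_law[OF h bdd, of \<one> "Suc n"] by simp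
    then show ?thesis
      using v by (subst expectation_pair_pmf_bounded[where B = C]) (auto simp: v_def)
  qed
  moreover have "measure_pmf.expectation \<mu> (\<lambda>x. (h x - h \<one>)\<^sup>2)
      = measure_pmf.expectation \<mu> (\<lambda>x. (h x - h \<one>) * h x)
        - measure_pmf.expectation \<mu> (\<lambda>x. (h x - h \<one>) * h \<one>)"
  proof -
    have "integrable (measure_pmf \<mu>) (\<lambda>x. (h x - h \<one>) * h (k x))" for k
    proof (rule integrable_bounded_pmf)
      fix x
      show "\<bar>(h x - h \<one>) * h (k x)\<bar> \<le> C"
        using v[of "(x, k x)"] by (simp only: v_def fst_conv snd_conv)
    qed
    from this[of "\<lambda>x. x"] this[of "\<lambda>_. \<one>"]
    have "integrable (measure_pmf \<mu>) (\<lambda>x. (h x - h \<one>) * h x)"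
      "integrable (measure_pmf \<mu>) (\<lambda>x. (h x - h \<one>) * h \<one>)" by simp_all
    then show ?thesis
      by (subst Bochner_Integration.integral_diff[symmetric])
         (auto simp: power2_eq_square algebra_simps)
  qed
  ultimately show ?thesis
    by (simp only: right_diff_distrib C_def)
qed

text \<open>
  In the previous inequality the error term is quadratic in \<open>t\<close> and the main term is linear, so a small
  \<open>t\<close> and an even smaller entropy increment rule out a positive variance.
\<close>

lemma harmonic_eq_one_on_support:
  assumes h: "harmonic G \<mu> h" and bdd: "\<And>x. \<bar>h x\<bar> \<le> B"
    and fin: "expected_information \<mu> < \<infinity>"
    and small: "\<And>\<epsilon>. \<epsilon> > 0 \<Longrightarrow> \<exists>n. entropy (Suc n) - entropy n < \<epsilon>"
    and x: "x \<in> set_pmf \<mu>"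
  shows "h x = h \<one>"
proof -
  let ?D = "measure_pmf.expectation \<mu> (\<lambda>x. (h x - h \<one>)\<^sup>2)"
  define C where "C = 2 * B\<^sup>2"
  have C: "0 \<le> C" by (simp add: C_def)
  have "?D \<le> 0"
  proof (rule ccontr)
    assume "\<not> ?D \<le> 0"
    then have D: "?D > 0" by simp
    \<comment> \<open>The first bound makes \<open>t C \<le> 1\<close>, the second makes the quadratic error at most half of \<open>t D\<close>.\<close>
    define t where "t = min (1 / (C + 1)) (?D / (2 * (C + 1)\<^sup>2))"
    have t: "t > 0" using C D by (simp add: t_def)
    have tC: "t * (C + 1) \<le> 1"
      using C mult_right_mono[of t "1 / (C + 1)" "C + 1"] by (simp add: t_def)
    have "t * (C + 1)\<^sup>2 \<le> ?D / 2"
      using C mult_right_mono[of t "?D / (2 * (C + 1)\<^sup>2)" "(C + 1)\<^sup>2"] by (simp add: t_def)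
    then have "t * (t * (C + 1)\<^sup>2) \<le> t * (?D / 2)"
      using t by (intro mult_left_mono) auto
    moreover have "(t * C)\<^sup>2 \<le> (t * (C + 1))\<^sup>2"
      using t C by (intro power_mono mult_left_mono) auto
    moreover have "(t * (C + 1))\<^sup>2 = t * (t * (C + 1)\<^sup>2)"
      by (simp only: power_mult_distrib power2_eq_square mult_ac)
    ultimately have quad: "(t * C)\<^sup>2 \<le> t * ?D / 2"
      by simp
    obtain n where "entropy (Suc n) - entropy n < t * ?D / 2"
      using small[of "t * ?D / 2"] t D by auto
    moreover have "t * C \<le> 1" using tC t by (simp add: algebra_simps)
    then have "t * ?D \<le> entropy (Suc n) - entropy n + (t * C)\<^sup>2"
      using harmonic_variance_le[OF h bdd fin, of t n] t by (simp add: C_def)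
    ultimately show False using quad by simp
  qed
  then have "?D = 0"
    by (intro antisym) (auto intro!: integral_nonneg_AE)
  moreover have "(h y - h \<one>)\<^sup>2 \<le> (2 * B)\<^sup>2" for y
    using bdd[of y] bdd[of \<one>] by (intro power2_le_iff_abs_le[THEN iffD2]) linarith+
  then have "integrable (measure_pmf \<mu>) (\<lambda>x. (h x - h \<one>)\<^sup>2)"
    by (intro integrable_bounded_pmf) auto
  ultimately have "AE y in \<mu>. (h y - h \<one>)\<^sup>2 = 0"
    by (subst integral_nonneg_eq_0_iff_AE[symmetric]) auto
  then show ?thesis
    using x by (auto simp: AE_measure_pmf_iff)
qed

lemma liouville_of_small_increments:
  assumes gen: "nondegenerate_pmf G \<mu>"
    and fin: "expected_information \<mu> < \<infinity>"
    and small: "\<And>\<epsilon>. \<epsilon> > 0 \<Longrightarrow> \<exists>n. entropy (Suc n) - entropy n < \<epsilon>"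
  shows "liouville G \<mu>"
  unfolding liouville_def
proof (intro allI impI, elim conjE)
  fix h :: "'a \<Rightarrow> real"
  assume h: "harmonic G \<mu> h" and "bounded (h ` carrier G)"
  then obtain B where B: "\<And>x. x \<in> carrier G \<Longrightarrow> \<bar>h x\<bar> \<le> B"
    by (auto simp: bounded_iff)
  have B0: "0 \<le> B" using B[of \<one>] by simp
  have step: "h (g \<otimes> x) = h g" if g: "g \<in> carrier G" and x: "x \<in> set_pmf \<mu>" for g x
  proof -
    \<comment> \<open>The left translate of \<open>h\<close> by \<open>g\<close>; outside the carrier it is set to \<open>0\<close> to be bounded everywhere.\<close>
    define k where "k = (\<lambda>y. if y \<in> carrier G then h (g \<otimes> y) else 0)"
    have "harmonic G \<mu> k"
      unfolding harmonic_def
    proof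
      fix y assume y: "y \<in> carrier G"
      have "((\<lambda>z. h (g \<otimes> y \<otimes> z) * pmf \<mu> z) has_sum h (g \<otimes> y)) (carrier G)"
        using h g y by (auto simp: harmonic_def)
      then show "((\<lambda>z. k (y \<otimes> z) * pmf \<mu> z) has_sum k y) (carrier G)"
        using g y by (subst has_sum_cong[where g = "\<lambda>z. h (g \<otimes> y \<otimes> z) * pmf \<mu> z"])
          (auto simp: k_def m_assoc)
    qed
    moreover have "\<bar>k y\<bar> \<le> B" for y
      using B B0 g by (simp add: k_def)
    ultimately have "k x = k \<one>"
      using fin small x by (rule harmonic_eq_one_on_support)
    then show ?thesis using g x supp by (auto simp: k_def subset_iff)
  qed
  have "h (g \<otimes> s) = h g" if "s \<in> generate G (set_pmf \<mu>)" "g \<in> carrier G" for g s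
    using that
  proof (induction arbitrary: g rule: generate.induct)
    case (inv x)
    then have x: "x \<in> carrier G" using supp by auto
    have "h (g \<otimes> inv x \<otimes> x) = h (g \<otimes> inv x)"
      using inv x by (intro step) auto
    then show ?case using inv x by (simp add: m_assoc)
  next
    case (eng s1 s2)
    have "s1 \<in> carrier G" "s2 \<in> carrier G"
      using eng generate_in_carrier[OF supp] by auto
    then show ?case using eng by (simp add: m_assoc[symmetric])
  qed (use step in auto)
  then have "h s = h \<one>" if "s \<in> carrier G" for s
    using gen that by (metis nondegenerate_pmf_def l_one one_closed)
  then show "h constant_on carrier G"
    unfolding constant_on_def by blast
qed

end

section \<open>Return probabilities of a symmetric walk\<close>

lemma (in group) pmf_map_inv:
  assumes "set_pmf p \<subseteq> carrier G" "g \<in> carrier G"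
  shows "pmf (map_pmf (\<lambda>x. inv x) p) g = pmf p (inv g)"
proof -
  have "pmf (map_pmf (\<lambda>x. inv x) p) g = measure p ((\<lambda>x. inv x) -` {g})"
    by (rule pmf_map)
  also have "\<dots> = measure p {inv g}"
    using assms by (intro measure_pmf.finite_measure_eq_AE AE_pmfI) auto
  finally show ?thesis by (simp add: measure_pmf_single)
qed

locale symmetric_random_walk = random_walk +
  assumes sym: "symmetric_pmf G \<mu>"
begin

text \<open>
  Inversion reverses the order of the factors, which does not change the law of a product of independent
  identically distributed symmetric factors.
\<close>

lemma map_inv_law: "map_pmf (\<lambda>x. inv x) (law n) = law n"
proof (induction n)
  case 0
  show ?case by simp
next
  case (Suc n)
  have "map_pmf (\<lambda>x. inv x) \<mu> = \<mu>"
  proof (rule pmf_eqI)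
    fix g
    show "pmf (map_pmf (\<lambda>x. inv x) \<mu>) g = pmf \<mu> g"
    proof (cases "g \<in> carrier G")
      case True
      then have "pmf \<mu> (inv g) = pmf \<mu> g"
        using sym by (metis symmetric_pmf_def)
      then show ?thesis using True by (simp only: pmf_map_inv[OF supp])
    next
      case False
      then have "g \<notin> set_pmf (map_pmf (\<lambda>x. inv x) \<mu>)" "g \<notin> set_pmf \<mu>"
        using supp by auto
      then show ?thesis by (simp only: set_pmf_iff not_not)
    qed
  qed
  moreover have "map_pmf (\<lambda>x. inv x) (convolution_pmf G p q)
      = convolution_pmf G (map_pmf (\<lambda>x. inv x) q) (map_pmf (\<lambda>x. inv x) p)"
    if "set_pmf p \<subseteq> carrier G" "set_pmf q \<subseteq> carrier G" for p q
  proof -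
    have "map_pmf (\<lambda>x. inv x) (convolution_pmf G p q)
        = map_pmf (\<lambda>e. inv snd e \<otimes> inv fst e) (pair_pmf p q)"
      unfolding convolution_pmf_def map_pmf_comp
      using that by (intro map_pmf_cong refl) (auto simp: inv_mult_group subset_iff)
    also have "\<dots> = convolution_pmf G (map_pmf (\<lambda>x. inv x) q) (map_pmf (\<lambda>x. inv x) p)"
      by (subst pair_commute_pmf)
        (simp only: convolution_pmf_def map_pair[symmetric] map_pmf_comp case_prod_beta' fst_conv snd_conv)
    finally show ?thesis .
  qed
  ultimately have "map_pmf (\<lambda>x. inv x) (law (Suc n)) = convolution_pmf G \<mu> (law n)"
    using supp supp_law[of n] Suc.IH by simp
  then show ?case by (simp only: law_Suc_left)
qed

lemma pmf_law_inv: "g \<in> carrier G \<Longrightarrow> pmf (law n) (inv g) = pmf (law n) g"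
  using pmf_map_inv[OF supp_law, of g n] by (simp add: map_inv_law)

text \<open>
  A return at time \<open>m + n\<close> splits at time \<open>m\<close> into two paths, and by symmetry the second one can be run
  backwards.
\<close>

lemma pmf_law_add_one:
  "ennreal (pmf (law (m + n)) \<one>) = (\<integral>\<^sup>+x. ennreal (pmf (law n) x) \<partial>law m)"
proof -
  have "ennreal (pmf (law (m + n)) \<one>) = (\<integral>\<^sup>+x. ennreal (pmf (law n) (inv x \<otimes> \<one>)) \<partial>law m)"
    unfolding law_add by (rule pmf_convolution[OF supp_law supp_law one_closed])
  also have "\<dots> = (\<integral>\<^sup>+x. ennreal (pmf (law n) x) \<partial>law m)"
    using supp_law[of m] by (intro nn_integral_cong_AE AE_pmfI) (auto simp: pmf_law_inv subset_iff)
  finally show ?thesis .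
qed

text \<open>
  Here \<open>P\<^bsub>2m\<^esub>(g)\<close> is the inner product of \<open>P\<^sub>m\<close> with a translate of itself, and \<open>P\<^bsub>2m\<^esub>(id)\<close> is its squared
  norm. The inequality \<open>2ab \<le> a\<^sup>2 + b\<^sup>2\<close>, summed over the group, replaces Cauchy--Schwarz.
\<close>

lemma pmf_even_law_le_one:
  assumes g: "g \<in> carrier G"
  shows "pmf (law (m + m)) g \<le> pmf (law (m + m)) \<one>"
proof -
  let ?P = "\<lambda>x. pmf (law m) x" and ?C = "count_space (carrier G)"
  have int_law: "(\<integral>\<^sup>+x. f x \<partial>law m) = (\<integral>\<^sup>+x. ennreal (?P x) * f x \<partial>?C)" for f :: "'a \<Rightarrow> ennreal"
  proof -
    have "(\<integral>\<^sup>+x. f x \<partial>law m) = (\<integral>\<^sup>+x. ennreal (?P x) * f x \<partial>count_space UNIV)"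
      by (rule nn_integral_measure_pmf)
    also have "\<dots> = (\<integral>\<^sup>+x. ennreal (?P x) * f x * indicator (carrier G) x \<partial>count_space UNIV)"
      using supp_law[of m] by (intro nn_integral_cong) (auto simp: indicator_def set_pmf_iff)
    finally show ?thesis by (simp add: nn_integral_count_space_indicator)
  qed
  have square: "(\<integral>\<^sup>+x. ennreal ((?P x)\<^sup>2) \<partial>?C) = ennreal (pmf (law (m + m)) \<one>)"
    unfolding pmf_law_add_one int_law by (simp add: power2_eq_square ennreal_mult)
  have cancel: "g \<otimes> (inv g \<otimes> x) = x" if "x \<in> carrier G" for x
    using g that by (simp add: m_assoc[symmetric])
  have "bij_betw (\<lambda>x. inv x \<otimes> g) (carrier G) (carrier G)"
    by (rule bij_betw_byWitness[where f' = "\<lambda>y. g \<otimes> inv y"])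
       (use g in \<open>auto simp: inv_mult_group m_assoc cancel\<close>)
  then have shift: "(\<integral>\<^sup>+x. ennreal ((?P (inv x \<otimes> g))\<^sup>2) \<partial>?C) = ennreal (pmf (law (m + m)) \<one>)"
    unfolding square[symmetric] by (rule nn_integral_bij_count_space)
  have "2 * ennreal (pmf (law (m + m)) g) = 2 * (\<integral>\<^sup>+x. ennreal (?P x) * ennreal (?P (inv x \<otimes> g)) \<partial>?C)"
    unfolding law_add pmf_convolution[OF supp_law supp_law g] int_law ..
  also have "\<dots> = (\<integral>\<^sup>+x. ennreal (2 * ?P x * ?P (inv x \<otimes> g)) \<partial>?C)"
    by (simp add: nn_integral_cmult[symmetric] ennreal_mult mult.assoc)
  also have "\<dots> \<le> (\<integral>\<^sup>+x. ennreal ((?P x)\<^sup>2 + (?P (inv x \<otimes> g))\<^sup>2) \<partial>?C)"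
    by (intro nn_integral_mono ennreal_leI sum_squares_bound)
  also have "\<dots> = 2 * ennreal (pmf (law (m + m)) \<one>)"
    by (simp add: nn_integral_add square shift mult_2)
  finally have "ennreal (2 * pmf (law (m + m)) g) \<le> ennreal (2 * pmf (law (m + m)) \<one>)"
    by (simp add: ennreal_mult)
  then show ?thesis by simp
qed

abbreviation return_prob :: "nat \<Rightarrow> real" where
  "return_prob m \<equiv> pmf (law (2 * m)) \<one>"

lemma pmf_le_return_prob: "g \<in> carrier G \<Longrightarrow> pmf (law (2 * m)) g \<le> return_prob m"
  unfolding mult_2 by (rule pmf_even_law_le_one)

lemma expectation_even_law:
  "measure_pmf.expectation (law (2 * k)) (pmf (law (2 * m))) = return_prob (m + k)"
proof -
  have "ennreal (measure_pmf.expectation (law (2 * k)) (pmf (law (2 * m))))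
      = (\<integral>\<^sup>+x. ennreal (pmf (law (2 * m)) x) \<partial>law (2 * k))"
    by (intro nn_integral_eq_integral[symmetric] integrable_bounded_pmf[where B = 1])
       (auto simp: pmf_le_1)
  also have "\<dots> = ennreal (return_prob (m + k))"
    unfolding pmf_law_add_one[symmetric] by (simp add: algebra_simps)
  finally show ?thesis
    by (subst (asm) ennreal_inj) (auto intro: integral_nonneg_AE)
qed

lemma return_prob_mono: "return_prob (m + k) \<le> return_prob m"
proof -
  have "measure_pmf.expectation (law (2 * k)) (pmf (law (2 * m)))
      \<le> measure_pmf.expectation (law (2 * k)) (\<lambda>_. return_prob m)"
    using supp_law[of "2 * k"] pmf_le_return_prob
    by (intro integral_mono_AE integrable_bounded_pmf[where B = 1] AE_pmfI)
       (auto simp: pmf_le_1 subset_iff)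
  then show ?thesis by (simp add: expectation_even_law)
qed

text \<open>
  The points \<open>0, k, 2k, \<dots>, k\<^sup>2\<close> cut the time axis into \<open>k\<close> blocks. If each of them lost more than a factor
  \<open>exp(-\<delta>)\<close>, the return probability at \<open>k\<^sup>2\<close> would fall below \<open>exp(-\<delta>k)\<close>. By monotonicity the lower bound
  at the end point holds at all these points.
\<close>

lemma exists_slow_decay_block:
  assumes k: "k > 0" and ret: "return_prob (k * k) \<ge> exp (- (\<delta> * real k))"
  shows "\<exists>m. return_prob m \<ge> exp (- (\<delta> * real k)) \<and> return_prob (m + k) \<ge> exp (- \<delta>) * return_prob m"
proof (rule ccontr)
  assume "\<not> ?thesis"
  then have fast: "return_prob (m + k) < exp (- \<delta>) * return_prob m"
    if "return_prob m \<ge> exp (- (\<delta> * real k))" for m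
    using that by fastforce
  have large: "return_prob (j * k) \<ge> exp (- (\<delta> * real k))" if "j \<le> k" for j
  proof -
    have "k * k = j * k + (k - j) * k"
      using that by (simp add: distrib_right[symmetric])
    then show ?thesis
      using ret return_prob_mono[of "j * k" "(k - j) * k"] by simp
  qed
  have "return_prob (Suc j * k) < exp (- (\<delta> * real (Suc j)))" if "j < k" for j
    using that
  proof (induction j)
    case 0
    then show ?case using fast[of 0] large[of 0] by (simp del: mult_Suc_right)
  next
    case (Suc j)
    have "return_prob (Suc (Suc j) * k) = return_prob (Suc j * k + k)"
      by (simp add: algebra_simps)
    also have "\<dots> < exp (- \<delta>) * return_prob (Suc j * k)"
      using Suc.prems by (intro fast large) simp
    also have "\<dots> \<le> exp (- \<delta>) * exp (- (\<delta> * real (Suc j)))"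
      using Suc by (intro mult_left_mono) auto
    also have "\<dots> = exp (- (\<delta> * real (Suc (Suc j))))"
      by (simp add: exp_add[symmetric] algebra_simps)
    finally show ?case .
  qed
  from this[of "k - 1"] k ret show False by simp
qed

text \<open>
  The information \<open>-ln p\<close> is compared with the information \<open>-ln q\<close> with respect to another distribution at
  the cost of \<open>q / p\<close>, whose mean under \<open>p\<close> is at most \<open>1\<close>. With \<open>f = q / a\<close> one has
  \<open>-ln q = -ln f - ln a\<close>; here \<open>-ln a \<le> D\<close>, and the weight \<open>f\<close> tames the first term since
  \<open>-f ln f \<le> 1 - f\<close>.
\<close>

lemma information_le_cross_information:
  fixes p q a D :: real
  assumes p: "0 < p" and q: "0 \<le> q" "q \<le> a" and a: "exp (- D) \<le> a" and D: "0 \<le> D"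
  shows "q / a * - ln p \<le> q / p + (1 + D)"
proof (cases "q = 0")
  case True
  then show ?thesis using D by simp
next
  case False
  have a_pos: "0 < a" using a exp_gt_zero less_le_trans by blast
  have q_pos: "0 < q" using q False by simp
  define f where "f = q / a"
  have f: "0 < f" "f \<le> 1" using q q_pos a_pos by (auto simp: f_def)
  have "ln (exp (- D)) \<le> ln a"
    using a by (intro ln_mono) auto
  then have ln_a: "- ln a \<le> D" by simp
  have "ln (q / p) \<le> q / p - 1"
    using q_pos p by (intro ln_le_minus_one) simp
  then have "- ln p \<le> q / p - 1 - ln f + D"
    using q_pos p a_pos ln_a by (simp add: f_def ln_div)
  then have "f * - ln p \<le> f * (q / p - 1 - ln f + D)"
    using f by (intro mult_left_mono) auto
  also have "\<dots> = f * (q / p) + f * D - f + f * ln (1 / f)"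
    using f by (simp add: ln_div algebra_simps)
  also have "\<dots> \<le> 1 * (q / p) + 1 * D - f + f * (1 / f - 1)"
    using f p q D by (intro add_mono diff_mono mult_right_mono mult_left_mono ln_le_minus_one) auto
  also have "\<dots> \<le> q / p + (1 + D)"
    using f by (simp add: algebra_simps)
  finally show ?thesis by (simp add: f_def)
qed

text \<open>
  The information at time \<open>2k\<close> is split with the weights \<open>f = P\<^bsub>2m\<^esub> / a\<^sub>m\<close> and \<open>1 - f\<close>. The first part is
  bounded by comparison with \<open>P\<^bsub>2m\<^esub>\<close>, which is large where \<open>f\<close> is; the second weight has mean
  \<open>1 - a\<^bsub>m+k\<^esub> / a\<^sub>m \<le> 1 - exp(-\<delta>) \<le> \<delta>\<close>.
\<close>

lemma expected_information_le_of_slow_decay: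
  assumes \<delta>: "\<delta> \<ge> 0"
    and low: "return_prob m \<ge> exp (- (\<delta> * real k))"
    and slow: "return_prob (m + k) \<ge> exp (- \<delta>) * return_prob m"
  shows "expected_information (law (2 * k)) \<le> ennreal (2 + \<delta> * real k)
    + of_nat (2 * k) * ((\<integral>\<^sup>+x. ennreal (- ln (pmf \<mu> x) - real M) \<partial>\<mu>) + of_nat M * ennreal \<delta>)"
proof -
  define a where "a = return_prob m"
  define f where "f = (\<lambda>x. if x \<in> carrier G then pmf (law (2 * m)) x / a else 0)"
  let ?p = "law (2 * k)"
  have a: "a > 0" using low exp_gt_zero less_le_trans unfolding a_def by blast
  have f: "0 \<le> f x" "f x \<le> 1" for x
    using a pmf_le_return_prob[of x m] by (auto simp: f_def a_def)
  have bulk: "ennreal (f x) * ennreal (info (2 * k) x)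
      \<le> ennreal (pmf (law (2 * m)) x / pmf ?p x) * 1 + ennreal (1 + \<delta> * real k)"
    if x: "x \<in> set_pmf ?p" for x
  proof -
    have xG: "x \<in> carrier G" using x supp_law by blast
    have "f x * info (2 * k) x \<le> pmf (law (2 * m)) x / pmf ?p x + (1 + \<delta> * real k)"
      using x xG low pmf_le_return_prob[OF xG, of m] \<delta> unfolding f_def a_def
      by (simp only: if_True) (intro information_le_cross_information, auto simp: pmf_positive)
    then have "ennreal (f x * info (2 * k) x)
        \<le> ennreal (pmf (law (2 * m)) x / pmf ?p x + (1 + \<delta> * real k))"
      by (rule ennreal_leI)
    also have "\<dots> = ennreal (pmf (law (2 * m)) x / pmf ?p x) + ennreal (1 + \<delta> * real k)"
      using \<delta> by (intro ennreal_plus) auto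
    finally show ?thesis
      by (simp only: ennreal_mult[OF f(1) neg_ln_pmf_nonneg] mult_1_right)
  qed
  have tail_mass: "(\<integral>\<^sup>+x. ennreal (1 - f x) \<partial>?p) \<le> ennreal \<delta>"
  proof -
    have "measure_pmf.expectation ?p f = measure_pmf.expectation ?p (\<lambda>x. pmf (law (2 * m)) x / a)"
      using supp_law[of "2 * k"] by (intro integral_cong_AE AE_pmfI) (auto simp: f_def subset_iff)
    also have "\<dots> = return_prob (m + k) / a"
      by (simp add: expectation_even_law)
    also have "\<dots> \<ge> exp (- \<delta>)"
      using slow a by (simp add: a_def field_simps)
    finally have "measure_pmf.expectation ?p f \<ge> exp (- \<delta>)" .
    moreover have "exp (- \<delta>) \<ge> 1 - \<delta>"
      using exp_ge_add_one_self[of "- \<delta>"] by simp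
    moreover have int_f: "integrable (measure_pmf ?p) f"
      using f by (intro integrable_bounded_pmf[where B = 1]) auto
    ultimately have "measure_pmf.expectation ?p (\<lambda>x. 1 - f x) \<le> \<delta>"
      by simp
    moreover have "(\<integral>\<^sup>+x. ennreal (1 - f x) \<partial>?p) = ennreal (measure_pmf.expectation ?p (\<lambda>x. 1 - f x))"
      using f int_f by (intro nn_integral_eq_integral) auto
    ultimately show ?thesis by (simp add: ennreal_leI)
  qed
  have "expected_information ?p
      = (\<integral>\<^sup>+x. ennreal (f x) * ennreal (info (2 * k) x) + ennreal (1 - f x) * ennreal (info (2 * k) x) \<partial>?p)"
    unfolding expected_information_def
  proof (rule nn_integral_cong)
    fix x
    have "ennreal (f x) + ennreal (1 - f x) = 1"
      using f[of x] by (simp add: ennreal_plus[symmetric] del: ennreal_plus)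
    then show "ennreal (info (2 * k) x)
        = ennreal (f x) * ennreal (info (2 * k) x) + ennreal (1 - f x) * ennreal (info (2 * k) x)"
      by (simp add: distrib_right[symmetric])
  qed
  also have "\<dots> = (\<integral>\<^sup>+x. ennreal (f x) * ennreal (info (2 * k) x) \<partial>?p)
      + (\<integral>\<^sup>+x. ennreal (1 - f x) * ennreal (info (2 * k) x) \<partial>?p)"
    by (rule nn_integral_add) auto
  also have "\<dots> \<le> ennreal (2 + \<delta> * real k)
      + of_nat (2 * k) * ((\<integral>\<^sup>+x. ennreal (- ln (pmf \<mu> x) - real M) \<partial>\<mu>) + of_nat M * ennreal \<delta>)"
  proof (rule add_mono)
    have "(\<integral>\<^sup>+x. ennreal (f x) * ennreal (info (2 * k) x) \<partial>?p)
        \<le> (\<integral>\<^sup>+x. ennreal (pmf (law (2 * m)) x / pmf ?p x) * 1 + ennreal (1 + \<delta> * real k) \<partial>?p)"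
      by (intro nn_integral_mono_AE AE_pmfI bulk)
    also have "\<dots> = (\<integral>\<^sup>+x. ennreal (pmf (law (2 * m)) x / pmf ?p x) * 1 \<partial>?p) + ennreal (1 + \<delta> * real k)"
      by (subst nn_integral_add) auto
    also have "\<dots> \<le> (\<integral>\<^sup>+x. 1 \<partial>law (2 * m)) + ennreal (1 + \<delta> * real k)"
      by (intro add_mono nn_integral_pmf_ratio_le order_refl)
    also have "\<dots> = ennreal 1 + ennreal (1 + \<delta> * real k)"
      by simp
    also have "\<dots> = ennreal (1 + (1 + \<delta> * real k))"
      using \<delta> by (intro ennreal_plus[symmetric]) auto
    finally show "(\<integral>\<^sup>+x. ennreal (f x) * ennreal (info (2 * k) x) \<partial>?p) \<le> ennreal (2 + \<delta> * real k)"
      by simp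
  next
    have "(\<integral>\<^sup>+x. ennreal (1 - f x) * ennreal (info (2 * k) x) \<partial>?p)
        \<le> of_nat (2 * k) * ((\<integral>\<^sup>+x. ennreal (- ln (pmf \<mu> x) - real M) \<partial>\<mu>)
          + of_nat M * (\<integral>\<^sup>+x. ennreal (1 - f x) \<partial>?p))"
      using f by (intro weighted_information_le) auto
    also have "\<dots> \<le> of_nat (2 * k) * ((\<integral>\<^sup>+x. ennreal (- ln (pmf \<mu> x) - real M) \<partial>\<mu>) + of_nat M * ennreal \<delta>)"
      by (intro mult_left_mono add_left_mono tail_mass) auto
    finally show "(\<integral>\<^sup>+x. ennreal (1 - f x) * ennreal (info (2 * k) x) \<partial>?p)
        \<le> of_nat (2 * k) * ((\<integral>\<^sup>+x. ennreal (- ln (pmf \<mu> x) - real M) \<partial>\<mu>) + of_nat M * ennreal \<delta>)" .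
  qed
  finally show ?thesis .
qed

text \<open>
  If all increments were at least \<open>\<epsilon>\<close>, the entropy at time \<open>2k\<close> would be at least \<open>2k\<epsilon>\<close>. The truncation
  level \<open>M\<close>, then \<open>\<delta>\<close> and finally \<open>k\<close> are chosen such that the upper bound is \<open>2 + k\<epsilon>/2\<close>, with
  \<open>k\<epsilon> > 2\<close>.
\<close>

lemma exists_small_entropy_increment:
  assumes fin: "expected_information \<mu> < \<infinity>"
    and ret: "\<And>\<delta>. \<delta> > 0 \<Longrightarrow> \<forall>\<^sub>F k in sequentially. return_prob (k * k) \<ge> exp (- (\<delta> * real k))"
    and \<epsilon>: "\<epsilon> > 0"
  shows "\<exists>n. entropy (Suc n) - entropy n < \<epsilon>"
proof (rule ccontr)
  assume "\<not> ?thesis"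
  then have "\<epsilon> \<le> entropy (Suc n) - entropy n" for n
    by (simp add: not_less)
  then have inc: "entropy n + \<epsilon> \<le> entropy (Suc n)" for n
    by (simp add: algebra_simps)
  have lower: "real n * \<epsilon> \<le> entropy n" for n
  proof (induction n)
    case 0
    then show ?case by (simp add: entropy_0)
  next
    case (Suc n)
    then show ?case using inc[of n] by (simp add: algebra_simps del: convolution_power.simps)
  qed
  let ?T = "\<lambda>M::nat. \<integral>\<^sup>+x. ennreal (- ln (pmf \<mu> x) - real M) \<partial>\<mu>"
  have "?T \<longlonglongrightarrow> 0"
    using fin unfolding expected_information_def by (rule nn_integral_excess_tendsto_0)
  then have "\<forall>\<^sub>F M in sequentially. ?T M < ennreal (\<epsilon> / 8)"
    using \<epsilon> by (intro order_tendstoD) auto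
  then obtain M where M: "?T M < ennreal (\<epsilon> / 8)"
    by (auto simp: eventually_sequentially)
  define \<delta> where "\<delta> = \<epsilon> / (8 * (real M + 1))"
  have \<delta>: "\<delta> > 0" using \<epsilon> by (simp add: \<delta>_def)
  have \<delta>M: "\<delta> * (real M + 1) = \<epsilon> / 8" by (simp add: \<delta>_def field_simps)
  have "\<forall>\<^sub>F k in sequentially. return_prob (k * k) \<ge> exp (- (\<delta> * real k)) \<and> nat \<lceil>2 / \<epsilon>\<rceil> < k"
    by (intro eventually_conj ret \<delta> eventually_gt_at_top)
  then obtain k where k: "return_prob (k * k) \<ge> exp (- (\<delta> * real k))" "nat \<lceil>2 / \<epsilon>\<rceil> < k"
    by (auto simp: eventually_sequentially)
  have "2 / \<epsilon> < real k" using k(2) by linarith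
  then have k_large: "2 < \<epsilon> * real k" using \<epsilon> by (simp add: field_simps)
  obtain m where m: "return_prob m \<ge> exp (- (\<delta> * real k))"
      "return_prob (m + k) \<ge> exp (- \<delta>) * return_prob m"
    using exists_slow_decay_block[OF _ k(1)] k(2) by auto
  have "ennreal (entropy (2 * k)) \<le> ennreal (2 + \<delta> * real k)
      + of_nat (2 * k) * (?T M + of_nat M * ennreal \<delta>)"
    unfolding ennreal_entropy[OF fin]
    using \<delta> m by (intro expected_information_le_of_slow_decay) auto
  also have "\<dots> \<le> ennreal (2 + \<delta> * real k)
      + of_nat (2 * k) * (ennreal (\<epsilon> / 8) + of_nat M * ennreal \<delta>)"
    using M by (intro add_left_mono mult_left_mono add_right_mono) auto
  also have "\<dots> = ennreal (2 + \<delta> * real k + real (2 * k) * (\<epsilon> / 8 + real M * \<delta>))"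
    using \<epsilon> \<delta> by (simp add: ennreal_of_nat_eq_real_of_nat ennreal_mult[symmetric]
      ennreal_plus[symmetric] del: ennreal_plus of_nat_mult)
  finally have "entropy (2 * k) \<le> 2 + \<delta> * real k + real (2 * k) * (\<epsilon> / 8 + real M * \<delta>)"
    using \<epsilon> \<delta> by (subst (asm) ennreal_le_iff) (auto intro!: add_nonneg_nonneg mult_nonneg_nonneg)
  also have "\<dots> \<le> 2 + 2 * real k * (\<epsilon> / 8 + \<delta> * (real M + 1))"
    using \<delta> by (simp add: algebra_simps)
  also have "\<dots> = 2 + \<epsilon> * real k / 2"
    unfolding \<delta>M by simp
  finally show False
    using lower[of "2 * k"] k_large by (simp add: algebra_simps)
qed

end

section \<open>Slow heat kernel decay implies the Liouville property\<close>

theorem theorem1p1: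
  fixes G :: "('a, 'b) monoid_scheme" and \<mu> :: "'a pmf" and \<gamma> :: "real \<Rightarrow> real"
  assumes "finitely_generated_group G"
    and "infinite (carrier G)"
    and "prob_measure_on G \<mu>"
    and "symmetric_pmf G \<mu>"
    and "nondegenerate_pmf G \<mu>"
    and "shannon_entropy G \<mu> < \<infinity>"
    and "\<And>x. x \<ge> 1 \<Longrightarrow> \<gamma> x > 0"
    and "\<not> bounded (\<gamma> ` {1..})"
    and "mono_on {1..} \<gamma>"
    and "mono_on {1..} (\<lambda>x. sqrt x / \<gamma> x)"
    and "((\<lambda>x. \<gamma> x / sqrt x) \<longlongrightarrow> 0) at_top"
    and "\<And>n::nat. n \<ge> 1 \<Longrightarrow>
           pmf (convolution_power G \<mu> (2 * n)) \<one>\<^bsub>G\<^esub> \<ge> exp (- \<gamma> (real n))"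
  shows "liouville G \<mu>"
proof -
  interpret group G
    using assms(1) by (simp add: finitely_generated_group_def)
  interpret symmetric_random_walk G \<mu>
    using assms(3,4) by unfold_locales (simp_all add: prob_measure_on_def)
  have fin: "expected_information \<mu> < \<infinity>"
    by (rule finite_shannon_entropyD[OF supp assms(6)])
  have "\<forall>\<^sub>F k in sequentially. return_prob (k * k) \<ge> exp (- (\<delta> * real k))" if \<delta>: "\<delta> > 0" for \<delta>
  proof -
    have "filterlim (\<lambda>k::nat. real k * real k) at_top sequentially"
      by (intro filterlim_at_top_mult_at_top filterlim_real_sequentially)
    then have "((\<lambda>k::nat. \<gamma> (real k * real k) / sqrt (real k * real k)) \<longlongrightarrow> 0) sequentially"
      by (rule filterlim_compose[OF assms(11)])
    then have "\<forall>\<^sub>F k::nat in sequentially. \<gamma> (real k * real k) / sqrt (real k * real k) < \<delta>"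
      using \<delta> by (rule order_tendstoD)
    then show ?thesis
      using eventually_gt_at_top[of 0]
    proof eventually_elim
      case (elim k)
      then have "\<gamma> (real (k * k)) \<le> \<delta> * real k"
        by (simp add: field_simps)
      then have "exp (- (\<delta> * real k)) \<le> exp (- \<gamma> (real (k * k)))"
        by simp
      also have "\<dots> \<le> return_prob (k * k)"
        using elim by (intro assms(12)) simp
      finally show ?case .
    qed
  qed
  then have "\<exists>n. entropy (Suc n) - entropy n < \<epsilon>" if "\<epsilon> > 0" for \<epsilon>
    using that by (intro exists_small_entropy_increment[OF fin])
  then show ?thesis
    by (rule liouville_of_small_increments[OF assms(5) fin])
qed

end
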